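(* Let $\Delta$ be a $(d-1)$-dimensional homology sphere with $h$-polynomial $h_\Delta(t)=\sum_{j=0}^dh_jt^j$, and put $\Phi_\Delta(z):=h_\Delta(1-z)$. Then $\Phi_\Delta$ is Möbius-covariant of weight $d$, i.e. $$\Phi_\Delta\!\left(-\frac{z}{1-z}\right)=(1-z)^{-d}\,\Phi_\Delta(z),$$ and for every integer $r\ge0$ and every formal power series $g\in\mathbb C[[z]]$, $$[z^r]\,g(z)\,h_\Delta(1-z)=[z^r]\,g\!\left(\frac{z}{1+z}\right)(1+z)^{r-1-d}\,h_\Delta(1+z).$$
   Context: $[z^r]H(z)$ denotes the coefficient of $z^r$ in the formal power series $H(z)$. A $(d-1)$-dimensional homology sphere (over a fixed field $k$) is a finite simplicial complex $\Delta$ of dimension $d-1$ such that for every face $\sigma$ (including $\sigma=\emptyset$) the link of $\sigma$ in $\Delta$ has the reduced homology over $k$ of a sphere of dimension $d-1-|\sigma|$. If $f_{i-1}$ is the number of faces with $i$ vertices ($f_{-1}=1$), the $h$-polynomial is defined by $h_\Delta(t)=\sum_{i=0}^df_{i-1}t^i(1-t)^{d-i}$. The Dehn–Sommerville relations for such $\Delta$ state $h_\Delta(t)=t^dh_\Delta(t^{-1})$. *)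

theory Defs
  imports "HOL-Library.Function_Algebras" "HOL-Computational_Algebra.Computational_Algebra"
begin

text \<open>A finite abstract simplicial complex is the set of its faces. The empty set is a face
  (\<open>f\<^sub>-\<^sub>1 = 1\<close>), so the void complex is excluded.\<close>

definition finite_complex :: "'v set set \<Rightarrow> bool" where
  "finite_complex K \<longleftrightarrow>
     finite K \<and> (\<forall>\<sigma>\<in>K. finite \<sigma>) \<and> {} \<in> K \<and> (\<forall>\<sigma>\<in>K. \<forall>\<tau>. \<tau> \<subseteq> \<sigma> \<longrightarrow> \<tau> \<in> K)"

definition complex_dim :: "'v set set \<Rightarrow> int" where
  "complex_dim K = int (Max (card ` K)) - 1"

definition link :: "'v set set \<Rightarrow> 'v set \<Rightarrow> 'v set set" where
  "link K \<sigma> = {\<tau>. \<tau> \<inter> \<sigma> = {} \<and> \<tau> \<union> \<sigma> \<in> K}"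


text \<open>Augmented simplicial chains over the field \<open>'k\<close>: a chain is its coefficient function
  on faces, and the degree \<open>i\<close> starts at \<open>-1\<close>, where the empty face lives. Faces are
  oriented by the linear order of the vertex type.\<close>

definition chain_scale :: "'k::field \<Rightarrow> ('v set \<Rightarrow> 'k) \<Rightarrow> 'v set \<Rightarrow> 'k" where
  "chain_scale a c = (\<lambda>\<sigma>. a * c \<sigma>)"

interpretation chain: vector_space "chain_scale :: 'k::field \<Rightarrow> ('v set \<Rightarrow> 'k) \<Rightarrow> 'v set \<Rightarrow> 'k"
  by unfold_locales (auto simp: chain_scale_def fun_eq_iff algebra_simps plus_fun_def)

definition chains :: "'v set set \<Rightarrow> int \<Rightarrow> ('v set \<Rightarrow> 'k::field) set" where
  "chains K i = {c. \<forall>\<sigma>. c \<sigma> \<noteq> 0 \<longrightarrow> \<sigma> \<in> K \<and> int (card \<sigma>) = i + 1}"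

text \<open>The usual boundary \<open>\<partial>[v\<^sub>0,\<dots>,v\<^sub>i] = (\<Sum>j\<le>i. (-1)^j [v\<^sub>0,\<dots>,v\<^sub>j\<^sub>-\<^sub>1,v\<^sub>j\<^sub>+\<^sub>1,\<dots>,v\<^sub>i])\<close> for
  \<open>v\<^sub>0 < \<dots> < v\<^sub>i\<close>, read off at the coefficient of a face \<open>\<tau>\<close>: it receives a contribution from
  each face \<open>insert v \<tau>\<close>, in which \<open>v\<close> has position \<open>card {w \<in> \<tau>. w < v}\<close>.\<close>

definition boundary ::
    "'v::linorder set set \<Rightarrow> ('v set \<Rightarrow> 'k::field) \<Rightarrow> 'v set \<Rightarrow> 'k" where
  "boundary K c \<tau> =
     (\<Sum>v | v \<notin> \<tau> \<and> insert v \<tau> \<in> K. (-1) ^ card {w \<in> \<tau>. w < v} * c (insert v \<tau>))"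

definition cycles :: "'v::linorder set set \<Rightarrow> int \<Rightarrow> ('v set \<Rightarrow> 'k::field) set" where
  "cycles K i = {c \<in> chains K i. boundary K c = 0}"

definition boundaries :: "'v::linorder set set \<Rightarrow> int \<Rightarrow> ('v set \<Rightarrow> 'k::field) set" where
  "boundaries K i = boundary K ` chains K (i + 1)"

text \<open>The dimension over \<open>'k\<close> of the reduced homology \<open>cycles K i / boundaries K i\<close>. For a finite
  complex the spaces are finite-dimensional and boundaries are cycles, so the subtraction does
  not truncate.\<close>

definition reduced_betti :: "'k::field itself \<Rightarrow> 'v::linorder set set \<Rightarrow> int \<Rightarrow> nat" where
  "reduced_betti _ K i =
     chain.dim (cycles K i :: ('v set \<Rightarrow> 'k) set) - chain.dim (boundaries K i :: ('v set \<Rightarrow> 'k) set)"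

text \<open>The reduced homology of the \<open>n\<close>-sphere is \<open>'k\<close> in degree \<open>n\<close> and zero otherwise; this
  includes \<open>n = -1\<close>, the sphere being empty.\<close>

definition has_sphere_homology :: "'k::field itself \<Rightarrow> 'v::linorder set set \<Rightarrow> int \<Rightarrow> bool" where
  "has_sphere_homology k K n \<longleftrightarrow> (\<forall>i. reduced_betti k K i = (if i = n then 1 else 0))"

text \<open>\<open>homology_sphere k d K\<close>: the dimension of the homology sphere \<open>K\<close> is \<open>d - 1\<close>.\<close>

definition homology_sphere :: "'k::field itself \<Rightarrow> nat \<Rightarrow> 'v::linorder set set \<Rightarrow> bool" where
  "homology_sphere k d K \<longleftrightarrow>
     finite_complex K \<and> complex_dim K = int d - 1 \<and>
     (\<forall>\<sigma>\<in>K. has_sphere_homology k (link K \<sigma>) (int d - 1 - int (card \<sigma>)))"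


text \<open>\<open>face_count K i\<close> is \<open>f\<^sub>i\<^sub>-\<^sub>1\<close>: the index is the number of vertices.\<close>

definition face_count :: "'v set set \<Rightarrow> nat \<Rightarrow> nat" where
  "face_count K i = card {\<sigma> \<in> K. card \<sigma> = i}"

definition h_poly :: "nat \<Rightarrow> 'v set set \<Rightarrow> 'a::comm_ring_1 poly" where
  "h_poly d K = (\<Sum>i\<le>d. of_nat (face_count K i) * [:0, 1:] ^ i * [:1, -1:] ^ (d - i))"

definition Phi :: "nat \<Rightarrow> 'v set set \<Rightarrow> 'a::comm_ring_1 poly" where
  "Phi d K = pcompose (h_poly d K) [:1, -1:]"

end

theory Submission
  imports Defs
begin

text \<open>
  The Euler--Poincare formula turns the homology of the links into
  \<open>\<Sum>\<rho>\<in>link \<Delta> \<sigma>. (-1)^|\<rho>| = (-1)^(d - |\<sigma>|)\<close>. Expanding \<open>(1 - x)^|\<tau>|\<close> over the subsets \<open>\<sigma>\<close> of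
  each face \<open>\<tau>\<close> and summing first over the link of \<open>\<sigma>\<close> gives the Dehn--Sommerville relations in the
  form \<open>\<Sum>i. f\<^sub>i\<^sub>-\<^sub>1 (1 - x)^i x^(d - i) = \<Sum>i. f\<^sub>i\<^sub>-\<^sub>1 (-x)^(d - i)\<close>, which needs no division. The left-hand
  side is \<open>\<Phi>(x)\<close>, and since \<open>1 - z\<close> and \<open>z\<close> become \<open>u\<close> and \<open>-x u\<close> for \<open>z = -x/(1 - x)\<close>,
  \<open>u = 1/(1 - x)\<close>, covariance is immediate. The coefficient identity is the substitution
  \<open>z = w/(1 + w)\<close>, under which \<open>[z^r] F(z) = [w^r] F(w/(1 + w)) (1 + w)^(r - 1)\<close>: for \<open>F = z^i\<close> with
  \<open>i < r\<close> the right-hand side is the coefficient of \<open>w^(r - i)\<close> in \<open>(1 + w)^(r - i - 1)\<close>.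
\<close>

subsection \<open>Euler characteristic and homology\<close>

text \<open>Rank-nullity, restricted to a subspace of a finite span because the space of all
  functions on vertex sets may be infinite-dimensional. A basis of the kernel is extended to one of
  \<open>V\<close>; the added vectors map to a basis of the image.\<close>

lemma (in vector_space_pair) dim_kernel_add_dim_image:
  assumes f: "Vector_Spaces.linear s1 s2 f" and V: "vs1.subspace V"
    and fin: "finite B0" "V \<subseteq> vs1.span B0"
  shows "vs1.dim V = vs1.dim {x \<in> V. f x = 0} + vs2.dim (f ` V)"
proof -
  obtain A where A: "A \<subseteq> {x \<in> V. f x = 0}" "vs1.independent A" "{x \<in> V. f x = 0} \<subseteq> vs1.span A"
    by (rule vs1.maximal_independent_subset)
  have "A \<subseteq> V" using A(1) by auto
  then obtain B where B: "A \<subseteq> B" "B \<subseteq> V" "vs1.independent B" "V \<subseteq> vs1.span B"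
    by (rule vs1.maximal_independent_subset_extend[OF _ A(2)])
  have finB: "finite B"
    using vs1.independent_span_bound[OF fin(1) B(3)] B(2) fin(2) by blast
  have spanB: "vs1.span B = V"
    using B V by (simp add: vs1.span_subspace)
  define D where "D = B - A"
  have D: "D \<subseteq> B" "vs1.independent D"
    using vs1.independent_mono[OF B(3), of D] by (auto simp: D_def)
  \<comment> \<open>Such an \<open>x\<close> lies in the spans of both \<open>A\<close> and
    \<open>D\<close>; these are disjoint parts of one basis, so all its coordinates vanish.\<close>
  have zero: "x = 0" if x: "x \<in> vs1.span D" "f x = 0" for x
  proof -
    have "x \<in> V"
      using x(1) vs1.span_mono[OF D(1)] spanB by auto
    then have xA: "x \<in> vs1.span A"
      using A(3) x(2) by auto
    have "vs1.representation B x b = 0" for b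
      using vs1.representation_extend[OF B(3) xA B(1)] vs1.representation_extend[OF B(3) x(1) D(1)]
        vs1.representation_ne_zero[of A x b] vs1.representation_ne_zero[of D x b]
      by (auto simp: D_def)
    then show "x = 0"
      using vs1.sum_nonzero_representation_eq[OF B(3), of x] \<open>x \<in> V\<close> spanB by simp
  qed
  have inj: "inj_on f (vs1.span D)"
    using linear_inj_on_iff_eq_0[OF f, of "vs1.span D"] zero by auto
  have "vs2.dim (f ` V) = card (f ` D)"
  proof (rule vs2.dim_unique)
    show "f ` D \<subseteq> f ` V"
      using D(1) B(2) by auto
    show "vs2.independent (f ` D)"
      using linear_independent_injective_image[OF f D(2) inj] .
    have "f b \<in> vs2.span (f ` D)" if "b \<in> B" for b
    proof (cases "b \<in> A")
      case True
      then have "f b = 0" using A(1) by auto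
      then show ?thesis by (simp add: vs2.span_zero)
    next
      case False
      with that show ?thesis by (auto simp: D_def intro: vs2.span_base)
    qed
    then have "vs2.span (f ` B) \<subseteq> vs2.span (f ` D)"
      by (intro vs2.span_minimal) auto
    then show "f ` V \<subseteq> vs2.span (f ` D)"
      using linear_span_image[OF f, of B] spanB by simp
  qed auto
  moreover have "card (f ` D) = card D"
    using inj vs1.span_superset by (intro card_image) (rule inj_on_subset)
  moreover have "vs1.dim {x \<in> V. f x = 0} = card A"
    using A by (intro vs1.dim_unique) auto
  moreover have "vs1.dim V = card B"
    using B by (intro vs1.dim_unique) auto
  moreover have "card B = card A + card D"
    using B(1) finB card_mono[of B A] by (simp add: D_def card_Diff_subset finite_subset)
  ultimately show ?thesis by simp
qed

section \<open>Chain spaces and their bases\<close>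

interpretation chain_pair: vector_space_pair
  "chain_scale :: 'k::field \<Rightarrow> ('v set \<Rightarrow> 'k) \<Rightarrow> 'v set \<Rightarrow> 'k"
  "chain_scale :: 'k \<Rightarrow> ('v set \<Rightarrow> 'k) \<Rightarrow> 'v set \<Rightarrow> 'k"
  by unfold_locales

lemma sum_apply_fun: "(\<Sum>a\<in>A. f a) x = (\<Sum>a\<in>A. f a x)" for f :: "'a \<Rightarrow> 'b \<Rightarrow> 'c::comm_monoid_add"
  by (induction A rule: infinite_finite_induct) auto

definition elementary_chain :: "'v set \<Rightarrow> 'v set \<Rightarrow> 'k::field" where
  "elementary_chain \<sigma> = (\<lambda>\<tau>. if \<tau> = \<sigma> then 1 else 0)"

lemma inj_elementary_chain: "inj_on (elementary_chain :: 'v set \<Rightarrow> 'v set \<Rightarrow> 'k::field) S"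
  by (rule inj_onI) (auto simp: elementary_chain_def fun_eq_iff split: if_splits)

lemma chain_expansion:
  assumes "finite S" "\<And>\<sigma>. c \<sigma> \<noteq> 0 \<Longrightarrow> \<sigma> \<in> S"
  shows "(\<Sum>\<sigma>\<in>S. chain_scale (c \<sigma>) (elementary_chain \<sigma>)) = c"
proof
  fix \<tau>
  have "(\<Sum>\<sigma>\<in>S. c \<sigma> * (if \<tau> = \<sigma> then 1 else 0)) = (\<Sum>\<sigma>\<in>S. if \<tau> = \<sigma> then c \<sigma> else 0)"
    by (intro sum.cong) auto
  also have "\<dots> = c \<tau>"
    using assms by auto
  finally show "(\<Sum>\<sigma>\<in>S. chain_scale (c \<sigma>) (elementary_chain \<sigma>)) \<tau> = c \<tau>"
    by (simp add: sum_apply_fun chain_scale_def elementary_chain_def)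
qed

text \<open>Supplies the finite spanning set that rank-nullity and the dimension bounds
  require.\<close>

lemma chains_subset_span:
  fixes K :: "'v set set"
  assumes "finite K"
  shows "(chains K i :: ('v set \<Rightarrow> 'k::field) set)
    \<subseteq> chain.span (elementary_chain ` {\<sigma> \<in> K. int (card \<sigma>) = i + 1})"
proof
  fix c :: "'v set \<Rightarrow> 'k"
  assume "c \<in> chains K i"
  then have "c = (\<Sum>\<sigma> | \<sigma> \<in> K \<and> int (card \<sigma>) = i + 1. chain_scale (c \<sigma>) (elementary_chain \<sigma>))"
    using assms by (subst chain_expansion) (auto simp: chains_def)
  also have "\<dots> \<in> chain.span (elementary_chain ` {\<sigma> \<in> K. int (card \<sigma>) = i + 1})"
    by (intro chain.span_sum chain.span_scale chain.span_base) auto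
  finally show "c \<in> chain.span (elementary_chain ` {\<sigma> \<in> K. int (card \<sigma>) = i + 1})" .
qed

lemma independent_elementary_chains:
  assumes "finite S"
  shows "chain.independent (elementary_chain ` S :: ('v set \<Rightarrow> 'k::field) set)"
proof (rule chain.independent_if_scalars_zero)
  fix a :: "('v set \<Rightarrow> 'k) \<Rightarrow> 'k" and x :: "'v set \<Rightarrow> 'k"
  assume 0: "(\<Sum>x\<in>elementary_chain ` S. chain_scale (a x) x) = 0" and "x \<in> elementary_chain ` S"
  then obtain \<sigma> where \<sigma>: "\<sigma> \<in> S" "x = elementary_chain \<sigma>" by auto
  \<comment> \<open>The scalars form one chain whose expansion is the vanishing combination;
    evaluating at \<sigma> isolates one scalar.\<close>
  define c where "c \<tau> = (if \<tau> \<in> S then a (elementary_chain \<tau>) else 0)" for \<tau>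
  have "c = (\<Sum>\<tau>\<in>S. chain_scale (c \<tau>) (elementary_chain \<tau>))"
    using assms by (subst chain_expansion) (auto simp: c_def split: if_splits)
  also have "\<dots> = (\<Sum>x\<in>elementary_chain ` S. chain_scale (a x) x)"
    by (subst sum.reindex[OF inj_elementary_chain]) (auto simp: c_def intro: sum.cong)
  finally have "c \<sigma> = 0" using 0 by simp
  with \<sigma> show "a x = 0" by (simp add: c_def)
qed (use assms in simp)

lemma subspace_chains: "chain.subspace (chains K i :: ('v set \<Rightarrow> 'k::field) set)"
proof (rule chain.subspaceI)
  fix c e :: "'v set \<Rightarrow> 'k"
  assume "c \<in> chains K i" "e \<in> chains K i"
  moreover have "c \<sigma> \<noteq> 0 \<or> e \<sigma> \<noteq> 0" if "(c + e) \<sigma> \<noteq> 0" for \<sigma>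
    using that by auto
  ultimately show "c + e \<in> chains K i"
    unfolding chains_def by blast
qed (auto simp: chains_def chain_scale_def)

lemma dim_chains:
  assumes "finite K"
  shows "chain.dim (chains K (int n - 1) :: ('v set \<Rightarrow> 'k::field) set) = face_count K n"
proof -
  let ?S = "{\<sigma> \<in> K. card \<sigma> = n}"
  have "chain.dim (chains K (int n - 1) :: ('v set \<Rightarrow> 'k) set)
      = card (elementary_chain ` ?S :: ('v set \<Rightarrow> 'k) set)"
  proof (rule chain.dim_unique)
    show "elementary_chain ` ?S \<subseteq> (chains K (int n - 1) :: ('v set \<Rightarrow> 'k) set)"
      by (auto simp: chains_def elementary_chain_def split: if_splits)
    show "(chains K (int n - 1) :: ('v set \<Rightarrow> 'k) set) \<subseteq> chain.span (elementary_chain ` ?S)"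
      using chains_subset_span[OF assms, of "int n - 1"] by simp
    show "chain.independent (elementary_chain ` ?S :: ('v set \<Rightarrow> 'k) set)"
      using assms by (intro independent_elementary_chains) auto
  qed simp
  then show ?thesis
    by (simp add: face_count_def card_image inj_elementary_chain)
qed

section \<open>The boundary map\<close>

lemma linear_boundary:
  "Vector_Spaces.linear chain_scale chain_scale (boundary K :: ('v::linorder set \<Rightarrow> 'k::field) \<Rightarrow> _)"
  unfolding Vector_Spaces.linear_iff
  by (auto intro!: chain.vector_space_axioms
      simp: boundary_def chain_scale_def fun_eq_iff distrib_left sum.distrib sum_distrib_left mult.left_commute)

lemma finite_complex_faceD:
  assumes "finite_complex K" "\<sigma> \<in> K" "\<tau> \<subseteq> \<sigma>"
  shows "\<tau> \<in> K" "finite \<tau>"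
  using assms by (auto simp: finite_complex_def intro: finite_subset)

lemma finite_cofaces:
  assumes "finite_complex K"
  shows "finite {v. v \<notin> \<tau> \<and> insert v \<tau> \<in> K}"
proof -
  have "{v. v \<notin> \<tau> \<and> insert v \<tau> \<in> K} \<subseteq> \<Union>K" by auto
  moreover have "finite (\<Union>K)" using assms by (auto simp: finite_complex_def)
  ultimately show ?thesis by (rule finite_subset)
qed

lemma boundary_boundary:
  fixes c :: "'v::linorder set \<Rightarrow> 'k::field"
  assumes K: "finite_complex K"
  shows "boundary K (boundary K c) = 0"
proof
  fix \<tau>
  define s :: "'v \<Rightarrow> 'v set \<Rightarrow> 'k" where "s v \<rho> = (-1) ^ card {w \<in> \<rho>. w < v}" for v \<rho>
  define g where "g v w = s v \<tau> * (s w (insert v \<tau>) * c (insert w (insert v \<tau>)))" for v w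
  let ?V = "\<lambda>\<rho>. {v. v \<notin> \<rho> \<and> insert v \<rho> \<in> K}"
  \<comment> \<open>Removing \<open>v\<close> and \<open>w\<close> in either order gives opposite signs. Pairing the two orders, rather than
    re-indexing the whole sum by the swap, also works in characteristic 2.\<close>
  define P where "P = {(v, w). v \<notin> \<tau> \<and> w \<notin> \<tau> \<and> v < w \<and> insert w (insert v \<tau>) \<in> K}"
  define Q where "Q = prod.swap ` P"
  have PQ: "Sigma (?V \<tau>) (\<lambda>v. ?V (insert v \<tau>)) = P \<union> Q"
  proof (intro subset_antisym subrelI)
    fix v w assume "(v, w) \<in> Sigma (?V \<tau>) (\<lambda>v. ?V (insert v \<tau>))"
    then show "(v, w) \<in> P \<union> Q"
      by (auto simp: P_def Q_def image_iff insert_commute)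
  next
    fix v w assume "(v, w) \<in> P \<union> Q"
    then have *: "v \<notin> \<tau>" "w \<notin> insert v \<tau>" "insert w (insert v \<tau>) \<in> K"
      by (auto simp: P_def Q_def insert_commute)
    moreover have "insert v \<tau> \<in> K"
      by (rule finite_complex_faceD(1)[OF K *(3)]) auto
    ultimately show "(v, w) \<in> Sigma (?V \<tau>) (\<lambda>v. ?V (insert v \<tau>))" by auto
  qed
  have fin: "finite (P \<union> Q)"
    unfolding PQ[symmetric] by (intro finite_SigmaI finite_cofaces K)
  have "boundary K (boundary K c) \<tau> = (\<Sum>v\<in>?V \<tau>. \<Sum>w\<in>?V (insert v \<tau>). g v w)"
    by (simp add: boundary_def g_def s_def sum_distrib_left)
  also have "\<dots> = (\<Sum>(v, w)\<in>P \<union> Q. g v w)"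
    unfolding PQ[symmetric] by (intro sum.Sigma ballI finite_cofaces K)
  also have "\<dots> = (\<Sum>(v, w)\<in>P. g v w) + (\<Sum>(v, w)\<in>Q. g v w)"
    using fin by (intro sum.union_disjoint) (auto simp: P_def Q_def)
  also have "(\<Sum>(v, w)\<in>Q. g v w) = (\<Sum>(v, w)\<in>P. g w v)"
    unfolding Q_def by (subst sum.reindex) (auto simp: case_prod_unfold)
  also have "(\<Sum>(v, w)\<in>P. g v w) + (\<Sum>(v, w)\<in>P. g w v) = (\<Sum>(v, w)\<in>P. g v w + g w v)"
    by (simp add: sum.distrib case_prod_unfold)
  also have "\<dots> = 0"
  proof (rule sum.neutral, clarify)
    fix v w assume "(v, w) \<in> P"
    then have vw: "v \<notin> \<tau>" "w \<notin> \<tau>" "v < w" "insert w (insert v \<tau>) \<in> K"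
      by (auto simp: P_def)
    have "finite \<tau>"
      by (rule finite_complex_faceD(2)[OF K vw(4)]) auto
    \<comment> \<open>Since \<open>v < w\<close>, adding \<open>v\<close> shifts the position of
      \<open>w\<close> by one, while adding \<open>w\<close> leaves that of \<open>v\<close>
      unchanged: exactly one sign flips.\<close>
    moreover have "{u \<in> insert v \<tau>. u < w} = insert v {u \<in> \<tau>. u < w}"
      using vw(3) by auto
    ultimately have "s w (insert v \<tau>) = - s w \<tau>"
      using vw(1) by (simp add: s_def)
    moreover have "{u \<in> insert w \<tau>. u < v} = {u \<in> \<tau>. u < v}"
      using vw(3) by auto
    then have "s v (insert w \<tau>) = s v \<tau>"
      by (simp add: s_def)
    ultimately show "g v w + g w v = 0"
      by (simp add: g_def insert_commute)
  qed
  finally show "boundary K (boundary K c) \<tau> = 0 \<tau>" by simp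
qed

lemma boundary_in_chains:
  assumes K: "finite_complex K" and c: "c \<in> chains K i"
  shows "boundary K c \<in> chains K (i - 1)"
proof -
  have "\<tau> \<in> K \<and> int (card \<tau>) = i" if nz: "boundary K c \<tau> \<noteq> 0" for \<tau>
  proof -
    obtain v where v: "v \<notin> \<tau>" "insert v \<tau> \<in> K" "c (insert v \<tau>) \<noteq> 0"
      by (rule sum.not_neutral_contains_not_neutral[OF nz[unfolded boundary_def]]) auto
    have "\<tau> \<in> K" "finite \<tau>"
      using finite_complex_faceD[OF K v(2), of \<tau>] by auto
    moreover have "int (card (insert v \<tau>)) = i + 1"
      using c v(3) by (auto simp: chains_def)
    ultimately show ?thesis using v(1) by simp
  qed
  then show ?thesis by (auto simp: chains_def)
qed

section \<open>Betti numbers and the Euler-Poincare formula\<close>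

lemma dim_chains_eq_cycles_boundaries:
  assumes K: "finite_complex K"
  shows "chain.dim (chains K i :: ('v::linorder set \<Rightarrow> 'k::field) set)
    = chain.dim (cycles K i :: ('v set \<Rightarrow> 'k) set) + chain.dim (boundaries K (i - 1) :: ('v set \<Rightarrow> 'k) set)"
proof -
  have "finite K"
    using K by (simp add: finite_complex_def)
  then show ?thesis
    unfolding cycles_def boundaries_def
    using chain_pair.dim_kernel_add_dim_image[OF linear_boundary[of K] subspace_chains _ chains_subset_span,
        of K i, where 'k='k]
    by simp
qed

lemma dim_cycles_eq_boundaries_betti:
  assumes K: "finite_complex K"
  shows "chain.dim (cycles K i :: ('v::linorder set \<Rightarrow> 'k::field) set)
    = chain.dim (boundaries K i :: ('v set \<Rightarrow> 'k) set) + reduced_betti TYPE('k) K i"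
proof -
  obtain Z :: "('v set \<Rightarrow> 'k) set" where
    Z: "Z \<subseteq> cycles K i" "chain.independent Z" "cycles K i \<subseteq> chain.span Z"
      "card Z = chain.dim (cycles K i :: ('v set \<Rightarrow> 'k) set)"
    by (rule chain.basis_exists)
  have "Z \<subseteq> chain.span (elementary_chain ` {\<sigma> \<in> K. int (card \<sigma>) = i + 1})"
    using Z(1) chains_subset_span[of K i] K by (auto simp: cycles_def finite_complex_def)
  then have "finite Z"
    using chain.independent_span_bound[OF _ Z(2), of "elementary_chain ` {\<sigma> \<in> K. int (card \<sigma>) = i + 1}"] K
    by (simp add: finite_complex_def)
  \<comment> \<open>This inclusion keeps the natural-number subtraction in
    \<open>reduced_betti\<close> from truncating.\<close>
  moreover have "boundaries K i \<subseteq> (cycles K i :: ('v set \<Rightarrow> 'k) set)"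
    using boundary_in_chains[OF K, of _ "i + 1"] boundary_boundary[OF K]
    by (auto simp: boundaries_def cycles_def)
  ultimately have "chain.dim (boundaries K i :: ('v set \<Rightarrow> 'k) set)
      \<le> chain.dim (cycles K i :: ('v set \<Rightarrow> 'k) set)"
    using chain.dim_le_card[of "boundaries K i" Z] Z by auto
  then show ?thesis by (simp add: reduced_betti_def)
qed

lemma face_count_eq_betti:
  assumes K: "finite_complex K"
  shows "face_count K n = chain.dim (boundaries K (int n - 1) :: ('v::linorder set \<Rightarrow> 'k::field) set)
    + chain.dim (boundaries K (int n - 2) :: ('v set \<Rightarrow> 'k) set) + reduced_betti TYPE('k) K (int n - 1)"
  using dim_chains[of K n, where 'k='k] dim_chains_eq_cycles_boundaries[OF K, of "int n - 1", where 'k='k]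
    dim_cycles_eq_boundaries_betti[OF K, of "int n - 1", where 'k='k] K
  by (simp add: finite_complex_def)

text \<open>A boundary in degree \<open>i\<close> comes from faces with \<open>i + 2\<close>
  vertices. The empty face is exempt because it is never of the form \<open>insert v \<tau>\<close>;
  this covers \<open>i = -2\<close>.\<close>

lemma boundaries_trivial:
  assumes "\<And>\<sigma>. \<sigma> \<in> K \<Longrightarrow> \<sigma> \<noteq> {} \<Longrightarrow> int (card \<sigma>) \<noteq> i + 2"
  shows "boundaries K i \<subseteq> {0 :: 'v::linorder set \<Rightarrow> 'k::field}"
  using assms by (auto simp: boundaries_def chains_def boundary_def fun_eq_iff intro!: sum.neutral) force

lemma euler_poincare:
  assumes K: "finite_complex K" and dim: "\<And>\<sigma>. \<sigma> \<in> K \<Longrightarrow> card \<sigma> \<le> N"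
  shows "(\<Sum>n\<le>N. (-1) ^ n * int (face_count K n))
    = (\<Sum>n\<le>N. (-1) ^ n * int (reduced_betti TYPE('k::field) (K :: 'v::linorder set set) (int n - 1)))"
proof -
  \<comment> \<open>\<open>b n\<close> is the rank of the boundary map on chains of
    \<open>n\<close>-vertex faces, which have degree \<open>n - 1\<close> and land in degree
    \<open>n - 2\<close>.\<close>
  define b where "b n = int (chain.dim (boundaries K (int n - 2) :: ('v set \<Rightarrow> 'k) set))" for n
  define \<beta> where "\<beta> n = int (reduced_betti TYPE('k) K (int n - 1))" for n
  have dim0: "chain.dim B = 0" if "B \<subseteq> {0}" for B :: "('v set \<Rightarrow> 'k) set"
    using that chain.dim_le_card[of B "{}"] by simp
  have "b 0 = 0"
    using K unfolding b_def of_nat_eq_0_iff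
    by (intro dim0 boundaries_trivial) (auto simp: finite_complex_def)
  moreover have "b (Suc N) = 0"
    unfolding b_def of_nat_eq_0_iff
    by (intro dim0 boundaries_trivial) (auto dest!: dim)
  moreover have "int (face_count K n) = b (Suc n) + b n + \<beta> n" for n
    using face_count_eq_betti[OF K, of n, where 'k='k] by (simp add: b_def \<beta>_def)
  \<comment> \<open>With alternating signs the ranks telescope; for \<open>m = N\<close> both
    remaining ends, \<open>b 0\<close> and \<open>b (Suc N)\<close>, vanish.\<close>
  then have "(\<Sum>n\<le>m. (-1) ^ n * int (face_count K n))
      = b 0 + (-1) ^ m * b (Suc m) + (\<Sum>n\<le>m. (-1) ^ n * \<beta> n)" for m
    by (induction m) (auto simp: algebra_simps)
  ultimately show ?thesis by (simp add: \<beta>_def)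
qed

subsection \<open>The Dehn--Sommerville relations\<close>

lemma finite_complex_link:
  assumes K: "finite_complex K" and \<sigma>: "\<sigma> \<in> K"
  shows "finite_complex (link K \<sigma>)"
proof -
  have sub: "link K \<sigma> \<subseteq> K"
    using finite_complex_faceD(1)[OF K] by (auto simp: link_def)
  then have "finite (link K \<sigma>)"
    using K by (auto simp: finite_complex_def intro: finite_subset)
  moreover have "finite \<tau>" if "\<tau> \<in> link K \<sigma>" for \<tau>
    using that sub K by (auto simp: finite_complex_def)
  moreover have "{} \<in> link K \<sigma>"
    using \<sigma> by (simp add: link_def)
  moreover have "\<tau> \<in> link K \<sigma>" if "\<rho> \<in> link K \<sigma>" "\<tau> \<subseteq> \<rho>" for \<rho> \<tau>
  proof -
    have "\<tau> \<union> \<sigma> \<in> K"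
      by (rule finite_complex_faceD(1)[OF K, of "\<rho> \<union> \<sigma>"]) (use that in \<open>auto simp: link_def\<close>)
    then show ?thesis using that by (auto simp: link_def)
  qed
  ultimately show ?thesis
    unfolding finite_complex_def by blast
qed

lemma sum_faces:
  fixes g :: "nat \<Rightarrow> 'a::comm_semiring_1"
  assumes "finite K" and dim: "\<And>\<sigma>. \<sigma> \<in> K \<Longrightarrow> card \<sigma> \<le> N"
  shows "(\<Sum>n\<le>N. of_nat (face_count K n) * g n) = (\<Sum>\<sigma>\<in>K. g (card \<sigma>))"
proof -
  have "(\<Sum>\<sigma>\<in>K. g (card \<sigma>)) = (\<Sum>n\<le>N. \<Sum>\<sigma> | \<sigma> \<in> K \<and> card \<sigma> = n. g (card \<sigma>))"
    using assms by (intro sum.group[symmetric]) auto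
  also have "\<dots> = (\<Sum>n\<le>N. of_nat (face_count K n) * g n)"
    by (simp add: face_count_def)
  finally show ?thesis by simp
qed

text \<open>Makes every exponent \<open>d - card \<sigma>\<close> a true difference.\<close>

lemma homology_sphere_card_le:
  assumes "homology_sphere k d K" "\<sigma> \<in> K"
  shows "card \<sigma> \<le> d"
proof -
  have "finite K" "Max (card ` K) = d"
    using assms(1) by (auto simp: homology_sphere_def finite_complex_def complex_dim_def)
  then show ?thesis
    using assms(2) Max_ge[of "card ` K" "card \<sigma>"] by simp
qed

lemma homology_sphere_euler:
  assumes sph: "homology_sphere TYPE('k::field) d (K :: 'v::linorder set set)" and \<sigma>: "\<sigma> \<in> K"
  shows "(\<Sum>\<rho>\<in>link K \<sigma>. (-1) ^ card \<rho>) = (-1 :: int) ^ (d - card \<sigma>)"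
proof -
  have K: "finite_complex K" and hom: "has_sphere_homology TYPE('k) (link K \<sigma>) (int d - 1 - int (card \<sigma>))"
    using sph \<sigma> by (auto simp: homology_sphere_def)
  note L = finite_complex_link[OF K \<sigma>]
  have dim: "card \<rho> \<le> d" if "\<rho> \<in> link K \<sigma>" for \<rho>
    using that finite_complex_faceD(1)[OF K] homology_sphere_card_le[OF sph] by (auto simp: link_def)
  have "(\<Sum>\<rho>\<in>link K \<sigma>. (-1 :: int) ^ card \<rho>) = (\<Sum>n\<le>d. (-1) ^ n * int (face_count (link K \<sigma>) n))"
    using L dim by (subst sum_faces[symmetric, of _ d]) (auto simp: finite_complex_def mult.commute)
  also have "\<dots> = (\<Sum>n\<le>d. (-1) ^ n * int (reduced_betti TYPE('k) (link K \<sigma>) (int n - 1)))"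
    by (rule euler_poincare[OF L dim])
  \<comment> \<open>The one nonzero Betti number of the link is in degree
    \<open>d - 1 - card \<sigma>\<close>, which is index \<open>n = d - card \<sigma>\<close> after
    the shift by one.\<close>
  also have "\<dots> = (\<Sum>n\<le>d. if n = d - card \<sigma> then (-1) ^ n else 0)"
    using hom homology_sphere_card_le[OF sph \<sigma>]
    by (intro sum.cong) (auto simp: has_sphere_homology_def)
  also have "\<dots> = (-1) ^ (d - card \<sigma>)"
    by simp
  finally show ?thesis .
qed

text \<open>With \<open>t = 1 - x\<close> the two sides are \<open>h(t)\<close> and
  \<open>t^d * h(1/t)\<close>, denominators cleared. A general ring lets \<open>x\<close> be the
  power series \<open>fps_X\<close> or \<open>- fps_X\<close>.\<close>

lemma dehn_sommerville:
  fixes x :: "'a::comm_ring_1"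
  assumes sph: "homology_sphere TYPE('k::field) d (K :: 'v::linorder set set)"
  shows "(\<Sum>i\<le>d. of_nat (face_count K i) * ((1 - x) ^ i * x ^ (d - i)))
    = (\<Sum>i\<le>d. of_nat (face_count K i) * (- x) ^ (d - i))"
proof -
  have K: "finite_complex K"
    using sph by (simp add: homology_sphere_def)
  then have fin: "finite K" by (simp add: finite_complex_def)
  note dim = homology_sphere_card_le[OF sph]
  have "(\<Sum>i\<le>d. of_nat (face_count K i) * ((1 - x) ^ i * x ^ (d - i)))
      = (\<Sum>\<tau>\<in>K. (1 - x) ^ card \<tau> * x ^ (d - card \<tau>))"
    by (rule sum_faces[OF fin dim])
  also have "\<dots> = (\<Sum>\<tau>\<in>K. \<Sum>\<sigma>\<in>Pow \<tau>. (-1) ^ card (\<tau> - \<sigma>) * x ^ (d - card \<sigma>))"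
  proof (rule sum.cong)
    fix \<tau> assume \<tau>: "\<tau> \<in> K"
    have fin\<tau>: "finite \<tau>"
      using finite_complex_faceD(2)[OF K \<tau>] by auto
    \<comment> \<open>In the product of \<open>1 + (- x)\<close> over the vertices of \<tau>,
      \<sigma> is the set of vertices contributing \<open>1\<close>.\<close>
    have "(1 - x) ^ card \<tau> = (\<Sum>\<sigma>\<in>Pow \<tau>. (- x) ^ card (\<tau> - \<sigma>))"
      using prod_add[OF fin\<tau>, of "\<lambda>_. 1" "\<lambda>_. - x"] by simp
    also have "\<dots> * x ^ (d - card \<tau>) = (\<Sum>\<sigma>\<in>Pow \<tau>. (-1) ^ card (\<tau> - \<sigma>) * x ^ (d - card \<sigma>))"
      unfolding sum_distrib_right
    proof (rule sum.cong)
      fix \<sigma> assume "\<sigma> \<in> Pow \<tau>"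
      \<comment> \<open>The powers of \<open>x\<close> combine to an exponent depending on \<sigma>
        alone, so \<tau> enters only through a sign.\<close>
      then have "card (\<tau> - \<sigma>) + (d - card \<tau>) = d - card \<sigma>"
        using fin\<tau> dim[OF \<tau>] card_mono[of \<tau> \<sigma>] by (auto simp: card_Diff_subset finite_subset)
      then show "(- x) ^ card (\<tau> - \<sigma>) * x ^ (d - card \<tau>) = (-1) ^ card (\<tau> - \<sigma>) * x ^ (d - card \<sigma>)"
        by (simp add: power_minus[of x] power_add[symmetric] mult.assoc)
    qed simp
    finally show "(1 - x) ^ card \<tau> * x ^ (d - card \<tau>)
        = (\<Sum>\<sigma>\<in>Pow \<tau>. (-1) ^ card (\<tau> - \<sigma>) * x ^ (d - card \<sigma>))" .
  qed simp
  also have "\<dots> = (\<Sum>(\<tau>, \<sigma>)\<in>Sigma K Pow. (-1) ^ card (\<tau> - \<sigma>) * x ^ (d - card \<sigma>))"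
    using fin finite_complex_faceD(2)[OF K] by (intro sum.Sigma) auto
  \<comment> \<open>A pair \<sigma> \<subseteq> \<tau> amounts to \<sigma> and a face \<rho> =
    \<tau> - \<sigma> of its link.\<close>
  also have "\<dots> = (\<Sum>(\<sigma>, \<rho>)\<in>Sigma K (link K). (-1) ^ card \<rho> * x ^ (d - card \<sigma>))"
    using finite_complex_faceD(1)[OF K]
    by (intro sum.reindex_bij_witness[where j = "\<lambda>(\<tau>, \<sigma>). (\<sigma>, \<tau> - \<sigma>)" and i = "\<lambda>(\<sigma>, \<rho>). (\<rho> \<union> \<sigma>, \<sigma>)"])
      (auto simp: link_def Un_absorb2)
  also have "\<dots> = (\<Sum>\<sigma>\<in>K. \<Sum>\<rho>\<in>link K \<sigma>. (-1) ^ card \<rho> * x ^ (d - card \<sigma>))"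
    using fin finite_complex_link[OF K] by (intro sum.Sigma[symmetric]) (auto simp: finite_complex_def)
  also have "\<dots> = (\<Sum>\<sigma>\<in>K. (- x) ^ (d - card \<sigma>))"
  proof (rule sum.cong)
    fix \<sigma> assume "\<sigma> \<in> K"
    \<comment> \<open>The Euler identity lives in the integers; \<open>of_int\<close> carries it to
      the ring.\<close>
    then have "of_int (\<Sum>\<rho>\<in>link K \<sigma>. (-1) ^ card \<rho>) = (of_int ((-1) ^ (d - card \<sigma>)) :: 'a)"
      using homology_sphere_euler[OF sph] by simp
    then have "(\<Sum>\<rho>\<in>link K \<sigma>. (-1) ^ card \<rho>) = (-1 :: 'a) ^ (d - card \<sigma>)"
      by simp
    then show "(\<Sum>\<rho>\<in>link K \<sigma>. (-1) ^ card \<rho> * x ^ (d - card \<sigma>)) = (- x) ^ (d - card \<sigma>)"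
      by (simp add: sum_distrib_right[symmetric] power_minus[of x])
  qed simp
  also have "\<dots> = (\<Sum>i\<le>d. of_nat (face_count K i) * (- x) ^ (d - i))"
    by (rule sum_faces[OF fin dim, symmetric])
  finally show ?thesis .
qed

subsection \<open>Change of variables in power series\<close>

lemma pcompose_h_poly:
  "pcompose (h_poly d K) q = (\<Sum>i\<le>d. of_nat (face_count K i) * q ^ i * (1 - q) ^ (d - i))"
proof -
  have "pcompose [:1, -1:] q = 1 - q"
    by (simp add: pcompose_pCons)
  moreover have "pcompose (of_nat n) q = of_nat n" for n
    by (simp add: of_nat_poly)
  moreover have "pcompose (p ^ n) q = pcompose p q ^ n" for p n
    by (induction n) (simp_all add: pcompose_1 pcompose_mult)
  ultimately show ?thesis
    by (simp add: h_poly_def pcompose_sum pcompose_mult pcompose_pCons one_pCons)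
qed

lemma fps_of_poly_of_nat: "fps_of_poly (of_nat n) = of_nat n"
  by (simp add: of_nat_poly fps_of_poly_const fps_of_nat)

lemma fps_of_poly_h_poly_one_minus:
  "fps_of_poly (pcompose (h_poly d K) [:1, -1:] :: complex poly)
    = (\<Sum>i\<le>d. of_nat (face_count K i) * ((1 - fps_X) ^ i * fps_X ^ (d - i)))"
proof -
  have "1 - [:1, -1:] = [:0, 1 :: complex:]" by (simp add: one_pCons)
  moreover have [simp]:
    "1 + fps_const (-1) * fps_X = 1 - (fps_X :: complex fps)"
    by (rule fps_ext) simp
  ultimately show ?thesis
    by (simp add: fps_of_poly_of_nat fps_of_poly_linear' pcompose_h_poly
        fps_of_poly_sum fps_of_poly_mult fps_of_poly_power mult.assoc)
qed

text \<open>Since \<open>1 - (1 + z) = - z\<close>, this is the left side of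
  \<open>dehn_sommerville\<close> at \<open>x = - fps_X\<close>.\<close>

lemma fps_of_poly_h_poly_one_plus:
  "fps_of_poly (pcompose (h_poly d K) [:1, 1:] :: complex poly)
    = (\<Sum>i\<le>d. of_nat (face_count K i) * ((1 + fps_X) ^ i * (- fps_X) ^ (d - i)))"
proof -
  have "1 - [:1, 1:] = - [:0, 1 :: complex:]" by (simp add: one_pCons)
  then show ?thesis
    by (simp add: fps_of_poly_of_nat fps_of_poly_linear' pcompose_h_poly
        fps_of_poly_sum fps_of_poly_mult fps_of_poly_power fps_of_poly_uminus mult.assoc
        del: minus_pCons)
qed

lemma fps_compose_mult_nth:
  fixes F :: "'a::idom fps"
  assumes G: "G $ 0 = 0"
  shows "((F oo G) * P) $ r = (\<Sum>i\<le>r. F $ i * (G ^ i * P) $ r)"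
proof -
  have G_nth: "(G ^ i) $ j = 0" if "j < i" for i j
    using startsby_zero_power_prefix[OF G] that by blast
  have "((F oo G) * P) $ r = (\<Sum>j\<le>r. (\<Sum>i\<le>j. F $ i * (G ^ i) $ j) * P $ (r - j))"
    by (simp add: fps_mult_nth fps_compose_nth atLeast0AtMost)
  \<comment> \<open>\<open>G ^ i\<close> has no terms below degree \<open>i\<close>, so the inner
    range may be made independent of \<open>j\<close> before swapping the sums.\<close>
  also have "\<dots> = (\<Sum>j\<le>r. \<Sum>i\<le>r. F $ i * (G ^ i) $ j * P $ (r - j))"
    unfolding sum_distrib_right
    by (intro sum.cong refl sum.mono_neutral_left) (auto simp: G_nth)
  also have "\<dots> = (\<Sum>i\<le>r. F $ i * (G ^ i * P) $ r)"
    by (subst sum.swap) (simp add: fps_mult_nth atLeast0AtMost sum_distrib_left mult.assoc)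
  finally show ?thesis .
qed

text \<open>\<open>power_int_diff\<close> is not available, since power series do not form a division ring.\<close>

lemma fps_power_int_diff:
  fixes u :: "'a::field fps"
  assumes u: "u $ 0 \<noteq> 0"
  shows "u powi (m - int n) = u powi m * inverse u ^ n"
proof (induction n)
  case (Suc n)
  have step: "u powi (k - 1) = u powi k * inverse u" for k
  proof (cases "k > 0")
    case True
    then obtain l where "k = int (Suc l)"
      using zero_less_imp_eq_int[of k] gr0_implies_Suc by blast
    then have "k - 1 = int l" "u powi k = u ^ l * u"
      by (simp_all only: power_int_of_nat) simp_all
    then show ?thesis
      using u by (simp add: inverse_mult_eq_1' mult.assoc)
  next
    case False
    then have "nat (1 - k) = Suc (nat (- k))"
      by simp
    then show ?thesis
      using False by (auto simp: power_int_def)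
  qed
  show ?case
    using step[of "m - int n"] Suc by (simp add: algebra_simps)
qed simp

text \<open>The exponent is that of a residue: \<open>z = w/(1 + w)\<close> has
  \<open>dz = dw/(1 + w)^2\<close> and \<open>z^(-r-1) = w^(-r-1) * (1 + w)^(r+1)\<close>. The proof
  checks it on monomials.\<close>

lemma fps_nth_change_of_variable:
  fixes F :: "'a::field fps"
  shows "((F oo (fps_X / (1 + fps_X))) * (1 + fps_X) powi (int r - 1)) $ r = F $ r"
proof -
  have unit: "(1 + fps_X :: 'a fps) $ 0 \<noteq> 0" by simp
  have X: "fps_X / (1 + fps_X) = fps_X * inverse (1 + fps_X :: 'a fps)"
    by (rule fps_divide_unit[OF unit])
  have inv: "inverse (1 + fps_X) * (1 + fps_X :: 'a fps) = 1"
    using unit by (rule inverse_mult_eq_1)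
  have "((fps_X / (1 + fps_X)) ^ i * (1 + fps_X) powi (int r - 1) :: 'a fps) $ r = (if i = r then 1 else 0)"
    if "i \<le> r" for i
  proof (cases "i = r")
    \<comment> \<open>Only the constant term beside \<open>fps_X ^ r\<close> counts, and it is 1
      even for \<open>r = 0\<close>, where the exponent is -1.\<close>
    case True
    then show ?thesis
      by (simp add: X power_mult_distrib mult.assoc fps_X_power_mult_nth fps_power_zeroth power_int_def)
  next
    case False
    with that obtain m where r: "r = i + Suc m"
      using less_imp_Suc_add[of i r] by auto
    \<comment> \<open>For \<open>i < r\<close> the exponent is nonnegative: \<open>i\<close> factors
      clear the denominator, leaving a polynomial of degree \<open>m\<close> whose coefficient at
      \<open>m + 1\<close> is sought.\<close>
    have "int r - 1 = int (i + m)" by (simp add: r)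
    then have "(1 + fps_X :: 'a fps) powi (int r - 1) = (1 + fps_X) ^ i * (1 + fps_X) ^ m"
      by (simp only: power_int_of_nat power_add)
    then have "(fps_X / (1 + fps_X)) ^ i * (1 + fps_X) powi (int r - 1)
        = fps_X ^ i * (inverse (1 + fps_X) * (1 + fps_X)) ^ i * (1 + fps_X :: 'a fps) ^ m"
      by (simp add: X power_mult_distrib mult_ac)
    also have "\<dots> = fps_X ^ i * fps_of_poly ([:1, 1:] ^ m)"
      by (simp add: inv fps_of_poly_power fps_of_poly_linear')
    also have "\<dots> $ r = coeff ([:1, 1 :: 'a:] ^ m) (Suc m)"
      by (simp add: r fps_X_power_mult_nth)
    also have "\<dots> = 0"
      by (rule coeff_eq_0) (simp add: degree_linear_power)
    finally show ?thesis using False by simp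
  qed
  then have "((F oo (fps_X / (1 + fps_X))) * (1 + fps_X) powi (int r - 1)) $ r
      = (\<Sum>i\<le>r. F $ i * (if i = r then 1 else 0))"
    by (subst fps_compose_mult_nth) (auto simp: X)
  then show ?thesis
    by (simp add: mult_delta_right)
qed


section \<open>Covariance and the coefficient identity\<close>

lemma h_sum_compose:
  fixes G :: "'a::idom fps"
  assumes G: "G $ 0 = 0"
  shows "(\<Sum>i\<le>d. of_nat (c i) * ((1 - fps_X) ^ i * fps_X ^ (d - i))) oo G
    = (\<Sum>i\<le>d. of_nat (c i) * ((1 - G) ^ i * G ^ (d - i)))"
  using G by (simp add: fps_compose_sum_distrib fps_compose_mult_distrib fps_compose_sub_distrib
      flip: fps_compose_power fps_of_nat)

text \<open>Each summand has exactly \<open>d\<close> factors \<open>u\<close>; this is the source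
  of the weight \<open>d\<close>.\<close>

lemma h_sum_rescale:
  fixes u :: "'a::comm_ring_1"
  shows "(\<Sum>i\<le>d. of_nat (c i) * (u ^ i * (x * u) ^ (d - i))) = u ^ d * (\<Sum>i\<le>d. of_nat (c i) * x ^ (d - i))"
  unfolding sum_distrib_left
proof (rule sum.cong)
  fix i assume "i \<in> {..d}"
  then have "u ^ d = u ^ i * u ^ (d - i)"
    by (simp flip: power_add)
  then show "of_nat (c i) * (u ^ i * (x * u) ^ (d - i)) = u ^ d * (of_nat (c i) * x ^ (d - i))"
    by (simp add: power_mult_distrib mult_ac)
qed simp

theorem corollary7p2:
  fixes \<Delta> :: "'v::linorder set set" and d :: nat
  assumes "homology_sphere TYPE('k::field) d \<Delta>"
  shows "fps_of_poly (Phi d \<Delta> :: complex poly) oo (- (fps_X / (1 - fps_X)))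
           = inverse ((1 - fps_X) ^ d) * fps_of_poly (Phi d \<Delta>) \<and>
         (\<forall>(r::nat) (g::complex fps).
           fps_nth (g * fps_of_poly (pcompose (h_poly d \<Delta>) [:1, -1:])) r
             = fps_nth ((g oo (fps_X / (1 + fps_X))) * (1 + fps_X) powi (int r - 1 - int d)
                        * fps_of_poly (pcompose (h_poly d \<Delta>) [:1, 1:])) r)"
proof (intro conjI allI)
  note DS = dehn_sommerville[OF assms]
  let ?\<Phi> = "fps_of_poly (Phi d \<Delta> :: complex poly)"
  let ?f = "\<lambda>i. of_nat (face_count \<Delta> i) :: complex fps"
  have \<Phi>: "?\<Phi> = (\<Sum>i\<le>d. ?f i * ((1 - fps_X) ^ i * fps_X ^ (d - i)))"
    by (simp add: Phi_def fps_of_poly_h_poly_one_minus)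
  show "?\<Phi> oo (- (fps_X / (1 - fps_X))) = inverse ((1 - fps_X) ^ d) * ?\<Phi>"
  proof -
    let ?u = "inverse (1 - fps_X :: complex fps)"
    have u: "(1 - fps_X) * ?u = 1"
      by (rule inverse_mult_eq_1') simp
    have G: "- (fps_X / (1 - fps_X)) = - fps_X * ?u"
      by (simp add: fps_divide_unit)
    have "1 - - fps_X * ?u = ?u"
      using u by (simp add: algebra_simps)
    then have "?\<Phi> oo (- (fps_X / (1 - fps_X))) = (\<Sum>i\<le>d. ?f i * (?u ^ i * (- fps_X * ?u) ^ (d - i)))"
      unfolding \<Phi> G by (subst h_sum_compose) simp_all
    \<comment> \<open>Rescaling leaves a sum in \<open>- fps_X\<close>, the right side of
      \<open>dehn_sommerville\<close> at \<open>fps_X\<close>, hence \<Phi> again.\<close>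
    also have "\<dots> = ?u ^ d * ?\<Phi>"
      unfolding h_sum_rescale \<Phi> DS ..
    finally show ?thesis
      by (simp add: fps_inverse_power)
  qed
  fix r :: nat and g :: "complex fps"
  let ?G = "fps_X / (1 + fps_X) :: complex fps"
  let ?h = "fps_of_poly (pcompose (h_poly d \<Delta>) [:1, 1 :: complex:])"
  let ?v = "inverse (1 + fps_X :: complex fps)"
  have v: "(1 + fps_X) * ?v = 1"
    by (rule inverse_mult_eq_1') simp
  have G: "?G = fps_X * ?v"
    by (simp add: fps_divide_unit)
  have "1 - fps_X * ?v = ?v"
    using v by (simp add: algebra_simps)
  then have "?\<Phi> oo ?G = (\<Sum>i\<le>d. ?f i * (?v ^ i * (fps_X * ?v) ^ (d - i)))"
    unfolding \<Phi> G by (subst h_sum_compose) simp_all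
  also have "\<dots> = ?v ^ d * (\<Sum>i\<le>d. ?f i * fps_X ^ (d - i))"
    by (rule h_sum_rescale)
  \<comment> \<open>The signs cancel at \<open>x = - fps_X\<close>, so this too is a right side of
    \<open>dehn_sommerville\<close>, now with left side \<open>?h\<close>.\<close>
  also have "(\<Sum>i\<le>d. ?f i * fps_X ^ (d - i)) = ?h"
    using DS[of "- fps_X :: complex fps"] by (simp add: fps_of_poly_h_poly_one_plus)
  finally have \<Phi>G: "?\<Phi> oo ?G = ?v ^ d * ?h" .
  \<comment> \<open>The substitution is applied to the whole product; the factor
    \<open>?v ^ d\<close> from \<Phi> then lowers the exponent \<open>r - 1\<close> by
    \<open>d\<close>.\<close>
  have "(g * ?\<Phi>) $ r = (((g * ?\<Phi>) oo ?G) * (1 + fps_X) powi (int r - 1)) $ r"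
    by (rule fps_nth_change_of_variable[symmetric])
  also have "((g * ?\<Phi>) oo ?G) = (g oo ?G) * (?v ^ d * ?h)"
    by (subst fps_compose_mult_distrib, simp add: G) (simp only: \<Phi>G)
  also have "\<dots> * (1 + fps_X) powi (int r - 1) = (g oo ?G) * ((1 + fps_X) powi (int r - 1) * ?v ^ d) * ?h"
    by (simp add: mult_ac)
  also have "(1 + fps_X) powi (int r - 1) * ?v ^ d = (1 + fps_X) powi (int r - 1 - int d)"
    by (rule fps_power_int_diff[symmetric]) simp
  finally show "(g * fps_of_poly (pcompose (h_poly d \<Delta>) [:1, -1:])) $ r
      = ((g oo ?G) * (1 + fps_X) powi (int r - 1 - int d) * ?h) $ r"
    by (simp add: Phi_def)
qed

end
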